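(* Let $T\in B(\mathcal H)$ be an essentially normal operator. If $\mathcal S(T,T^* )$ is an SI semigroup, then either $\sigma_e(T)\subset\mathbb R$ or $\sigma_e(T)\subset S^1\cup\{0\}$.
   Context: $\mathcal H$ is a complex Hilbert space, $K(\mathcal H)$ the compact operators, and $\pi:B(\mathcal H)\to B(\mathcal H)/K(\mathcal H)$ the quotient map onto the Calkin algebra. $T$ is essentially normal if $\pi(T)$ is normal; $\sigma_e(T)=\sigma(\pi(T))$ is the essential spectrum; $S^1$ is the unit circle. $\mathcal S(T,T^* )$ is the multiplicative semigroup of all finite nonempty products of $T$ and $T^*$. An ideal of a semigroup $\mathcal S$ is a nonempty subset $J\subset\mathcal S$ with $XA,AX\in J$ for $A\in J$, $X\in\mathcal S$. $\mathcal S$ is an SI (selfadjoint-ideal) semigroup if every ideal $J$ of $\mathcal S$ satisfies $J^*=\{A^*:A\in J\}\subset J$. *)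

theory Defs
  imports "HOL-Analysis.Analysis" "HOL-Algebra.QuotRing"
begin

subsection \<open>Complex Hilbert spaces\<close>

class complex_vector = real_vector +
  fixes scaleC :: "complex \<Rightarrow> 'a \<Rightarrow> 'a"  (infixr "*\<^sub>C" 75)
  assumes scaleC_add_right: "c *\<^sub>C (x + y) = c *\<^sub>C x + c *\<^sub>C y"
    and scaleC_add_left: "(c + d) *\<^sub>C x = c *\<^sub>C x + d *\<^sub>C x"
    and scaleC_scaleC: "c *\<^sub>C d *\<^sub>C x = (c * d) *\<^sub>C x"
    and scaleC_of_real: "complex_of_real r *\<^sub>C x = r *\<^sub>R x"

text \<open>
  The complex inner product is linear in its first argument. Its real part is the inner product
  of the underlying real Hilbert space; through \<^class>\<open>real_inner\<close> this supplies positive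
  definiteness and says that the norm is the one induced by \<open>cinner\<close>.
\<close>

class complex_hilbert = complex_vector + real_inner + complete_space +
  fixes cinner :: "'a \<Rightarrow> 'a \<Rightarrow> complex"
  assumes cinner_add_left: "cinner (x + y) z = cinner x z + cinner y z"
    and cinner_scaleC_left: "cinner (c *\<^sub>C x) y = c * cinner x y"
    and cinner_commute: "cinner x y = cnj (cinner y x)"
    and Re_cinner: "Re (cinner x y) = inner x y"

subsection \<open>Bounded and compact operators\<close>

definition bounded_ops :: "('a::complex_hilbert \<Rightarrow> 'a) set" where
  "bounded_ops = {T. bounded_linear T \<and> (\<forall>c x. T (c *\<^sub>C x) = c *\<^sub>C T x)}"

definition compact_ops :: "('a::complex_hilbert \<Rightarrow> 'a) set" where
  "compact_ops = {T \<in> bounded_ops. compact (closure (T ` cball 0 1))}"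

definition cadjoint :: "('a::complex_hilbert \<Rightarrow> 'a) \<Rightarrow> 'a \<Rightarrow> 'a" where
  "cadjoint T = (SOME S. \<forall>x y. cinner (T x) y = cinner x (S y))"

definition op_ring :: "('a::complex_hilbert \<Rightarrow> 'a) ring" where
  "op_ring = \<lparr>carrier = bounded_ops, mult = (\<circ>), one = id,
     zero = (\<lambda>x. 0), add = (\<lambda>S T x. S x + T x)\<rparr>"

lemma ring_op_ring: "ring (op_ring :: ('a::complex_hilbert \<Rightarrow> 'a) ring)"
proof (rule ringI)
  show "abelian_group (op_ring :: ('a \<Rightarrow> 'a) ring)"
  proof (rule abelian_groupI)
    fix T :: "'a \<Rightarrow> 'a" assume T: "T \<in> carrier op_ring"
    have neg: "c *\<^sub>C (- x) = - (c *\<^sub>C x)" for c and x :: 'a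
    proof -
      have "c *\<^sub>C (- x) + c *\<^sub>C x = c *\<^sub>C 0" by (simp flip: scaleC_add_right)
      also have "c *\<^sub>C (0::'a) = 0"
        using scaleC_add_right[of c 0 "0::'a"] by simp
      finally show ?thesis by (simp add: eq_neg_iff_add_eq_0)
    qed
    show "\<exists>S \<in> carrier op_ring. S \<oplus>\<^bsub>op_ring\<^esub> T = \<zero>\<^bsub>op_ring\<^esub>"
      using T by (intro bexI[of _ "\<lambda>x. - T x"])
        (auto simp: op_ring_def bounded_ops_def neg intro: bounded_linear_minus)
  next
    have "c *\<^sub>C (0::'a) = 0" for c
      using scaleC_add_right[of c 0 "0::'a"] by simp
    then show "\<zero>\<^bsub>op_ring\<^esub> \<in> carrier (op_ring :: ('a \<Rightarrow> 'a) ring)"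
      by (auto simp: op_ring_def bounded_ops_def)
  qed (auto simp: op_ring_def bounded_ops_def scaleC_add_right add_ac fun_eq_iff
      intro: bounded_linear_add)
  show "monoid (op_ring :: ('a \<Rightarrow> 'a) ring)"
    by (rule monoidI)
      (auto simp: op_ring_def bounded_ops_def o_def id_def intro: bounded_linear_compose)
qed (auto simp: op_ring_def bounded_ops_def fun_eq_iff bounded_linear.linear linear_add)

lemma compact_closure_subset:
  fixes A B :: "'a::metric_space set"
  assumes "A \<subseteq> B" "compact B"
  shows "compact (closure A)"
proof -
  have "B \<inter> closure A = closure A"
    using assms by (simp add: closure_minimal compact_imp_closed inf.absorb2)
  then show ?thesis
    using compact_Int_closed[OF assms(2) closed_closure[of A]] by simp
qed

lemma ideal_compact_ops: "ideal compact_ops (op_ring :: ('a::complex_hilbert \<Rightarrow> 'a) ring)"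
proof -
  interpret ring "op_ring :: ('a \<Rightarrow> 'a) ring" by (rule ring_op_ring)
  have bl: "bounded_linear T" if "T \<in> bounded_ops" for T :: "'a \<Rightarrow> 'a"
    using that by (simp add: bounded_ops_def)
  have compI: "S \<in> compact_ops"
    if "S \<in> bounded_ops" "S ` cball 0 1 \<subseteq> B" "compact B" for S :: "'a \<Rightarrow> 'a" and B
    using that(1) compact_closure_subset[OF that(2,3)] by (simp add: compact_ops_def)
  have cl: "T x \<in> closure (T ` cball 0 1)" if "norm x \<le> 1" for T :: "'a \<Rightarrow> 'a" and x
    using that by (intro subsetD[OF closure_subset] imageI) simp
  have left: "S \<circ> T \<in> compact_ops" if "T \<in> compact_ops" "S \<in> bounded_ops" for S T :: "'a \<Rightarrow> 'a"
  proof (rule compI)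
    have "T \<in> bounded_ops" using that by (simp add: compact_ops_def)
    then show "S \<circ> T \<in> bounded_ops"
      using that m_closed[of S T] by (simp add: op_ring_def)
    show "(S \<circ> T) ` cball 0 1 \<subseteq> S ` closure (T ` cball 0 1)"
      using cl by auto
    show "compact (S ` closure (T ` cball 0 1))"
      using that bl by (intro compact_continuous_image linear_continuous_on)
        (auto simp: compact_ops_def)
  qed
  have right: "T \<circ> S \<in> compact_ops" if TS: "T \<in> compact_ops" "S \<in> bounded_ops" for S T :: "'a \<Rightarrow> 'a"
  proof -
    obtain b where b: "b > 0" "\<And>x. norm (S x) \<le> norm x * b"
      using bounded_linear.pos_bounded[OF bl[OF TS(2)]] by blast
    have T: "T \<in> bounded_ops" using that by (simp add: compact_ops_def)
    show ?thesis
    proof (rule compI)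
      show "T \<circ> S \<in> bounded_ops"
        using that T m_closed[of T S] by (simp add: op_ring_def)
      show "(T \<circ> S) ` cball 0 1 \<subseteq> (\<lambda>y. b *\<^sub>R y) ` closure (T ` cball 0 1)"
      proof clarify
        fix x :: 'a assume "x \<in> cball 0 1"
        then have "norm x * b \<le> 1 * b"
          using b(1) by (intro mult_right_mono) auto
        then have "norm (S x) \<le> b" using b(2)[of x] by simp
        then have "norm ((1 / b) *\<^sub>R S x) \<le> 1" using b(1) by (simp add: divide_simps)
        moreover have "(T \<circ> S) x = b *\<^sub>R T ((1 / b) *\<^sub>R S x)"
          using b(1) bl[OF T] by (simp add: linear_scale bounded_linear.linear)
        ultimately show "(T \<circ> S) x \<in> (\<lambda>y. b *\<^sub>R y) ` closure (T ` cball 0 1)"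
          using cl by blast
      qed
      show "compact ((\<lambda>y. b *\<^sub>R y) ` closure (T ` cball 0 1))"
        using that by (intro compact_scaling) (simp add: compact_ops_def)
    qed
  qed
  have zero: "(\<lambda>x. 0) \<in> (compact_ops :: ('a \<Rightarrow> 'a) set)"
    by (rule compI[where B = "{0}"]) (use zero_closed in \<open>auto simp: op_ring_def\<close>)
  have add: "(\<lambda>x. S x + T x) \<in> compact_ops"
    if "S \<in> compact_ops" "T \<in> compact_ops" for S T :: "'a \<Rightarrow> 'a"
  proof (rule compI)
    have "S \<in> bounded_ops" "T \<in> bounded_ops" using that by (auto simp: compact_ops_def)
    then show "(\<lambda>x. S x + T x) \<in> bounded_ops"
      using a_closed[of S T] by (simp add: op_ring_def)
    show "(\<lambda>x. S x + T x) ` cball 0 1 \<subseteq>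
        {x + y |x y. x \<in> closure (S ` cball 0 1) \<and> y \<in> closure (T ` cball 0 1)}"
      using cl by fastforce
    show "compact {x + y |x y. x \<in> closure (S ` cball 0 1) \<and> y \<in> closure (T ` cball 0 1)}"
      using that by (intro compact_sums) (auto simp: compact_ops_def)
  qed
  have sub: "T \<in> carrier op_ring" if "T \<in> compact_ops" for T :: "'a \<Rightarrow> 'a"
    using that by (simp add: compact_ops_def op_ring_def)
  show ?thesis
  proof (rule idealI)
    show "ring (op_ring :: ('a \<Rightarrow> 'a) ring)" by (rule ring_op_ring)
    show "subgroup compact_ops (add_monoid (op_ring :: ('a \<Rightarrow> 'a) ring))"
    proof (rule add.subgroupI)
      fix T :: "'a \<Rightarrow> 'a" assume T: "T \<in> compact_ops"
      have "\<ominus>\<^bsub>op_ring\<^esub> T = (\<ominus>\<^bsub>op_ring\<^esub> \<one>\<^bsub>op_ring\<^esub>) \<otimes>\<^bsub>op_ring\<^esub> T"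
        using sub[OF T] by (simp add: l_minus)
      also have "\<dots> = (\<ominus>\<^bsub>op_ring\<^esub> \<one>\<^bsub>op_ring\<^esub>) \<circ> T"
        by (simp add: op_ring_def)
      also have "\<dots> \<in> compact_ops"
        using a_inv_closed[OF one_closed] by (intro left T) (simp add: op_ring_def)
      finally show "\<ominus>\<^bsub>op_ring\<^esub> T \<in> compact_ops" .
    qed (use sub zero add in \<open>auto simp: op_ring_def\<close>)
  qed (use left right in \<open>auto simp: op_ring_def\<close>)
qed

subsection \<open>The Calkin algebra\<close>

definition calkin :: "('a::complex_hilbert \<Rightarrow> 'a) set ring" where
  "calkin = op_ring Quot compact_ops"

definition calkin_proj :: "('a::complex_hilbert \<Rightarrow> 'a) \<Rightarrow> ('a \<Rightarrow> 'a) set" where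
  "calkin_proj T = compact_ops +>\<^bsub>op_ring\<^esub> T"

text \<open>
  Elements of the Calkin algebra are cosets. The involution maps the coset of \<open>T\<close> to the coset of
  its adjoint; since the compact operators are closed under adjoints, this is the elementwise image.
\<close>

definition calkin_star :: "('a::complex_hilbert \<Rightarrow> 'a) set \<Rightarrow> ('a \<Rightarrow> 'a) set" where
  "calkin_star X = cadjoint ` X"

definition calkin_normal :: "('a::complex_hilbert \<Rightarrow> 'a) set \<Rightarrow> bool" where
  "calkin_normal X \<longleftrightarrow> calkin_star X \<otimes>\<^bsub>calkin\<^esub> X = X \<otimes>\<^bsub>calkin\<^esub> calkin_star X"

text \<open>
  On a finite-dimensional space the Calkin algebra is the zero ring, whose only element is a unit;
  all spectra are then empty.
\<close>

definition calkin_spectrum :: "('a::complex_hilbert \<Rightarrow> 'a) set \<Rightarrow> complex set" where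
  "calkin_spectrum X = {z. X \<ominus>\<^bsub>calkin\<^esub> calkin_proj (\<lambda>x. z *\<^sub>C x) \<notin> Units calkin}"

definition essentially_normal :: "('a::complex_hilbert \<Rightarrow> 'a) \<Rightarrow> bool" where
  "essentially_normal T \<longleftrightarrow> calkin_normal (calkin_proj T)"

definition essential_spectrum :: "('a::complex_hilbert \<Rightarrow> 'a) \<Rightarrow> complex set" where
  "essential_spectrum T = calkin_spectrum (calkin_proj T)"

subsection \<open>Semigroups of operators and their ideals\<close>

definition op_semigroup :: "('a::complex_hilbert \<Rightarrow> 'a) \<Rightarrow> ('a \<Rightarrow> 'a) set" where
  "op_semigroup T = {foldr (\<circ>) ws id | ws. ws \<noteq> [] \<and> set ws \<subseteq> {T, cadjoint T}}"

definition semigroup_ideal :: "('a \<Rightarrow> 'a) set \<Rightarrow> ('a \<Rightarrow> 'a) set \<Rightarrow> bool" where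
  "semigroup_ideal J S \<longleftrightarrow>
     J \<noteq> {} \<and> J \<subseteq> S \<and> (\<forall>A\<in>J. \<forall>X\<in>S. X \<circ> A \<in> J \<and> A \<circ> X \<in> J)"

definition SI_semigroup :: "('a::complex_hilbert \<Rightarrow> 'a) set \<Rightarrow> bool" where
  "SI_semigroup S \<longleftrightarrow> (\<forall>J. semigroup_ideal J S \<longrightarrow> cadjoint ` J \<subseteq> J)"

end

theory Submission
  imports Defs
begin

text \<open>
  The operator \<open>T\<close> together with all words of length at least two in \<open>T\<close> and \<open>T\<^sup>*\<close> is an ideal, so
  the SI property gives \<open>T\<^sup>* = T\<close> or \<open>T\<^sup>* = W\<close> for a word \<open>W\<close> of length \<open>n \<ge> 2\<close>. Fix \<open>z\<close> and put
  \<open>S = T - z\<close>. Modulo the left ideal generated by \<open>S\<close> and \<open>S\<^sup>*\<close>, every word is a scalar, namely the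
  corresponding product of copies of \<open>z\<close> and its conjugate. If this scalar differs for \<open>T\<^sup>*\<close> and \<open>W\<close>
  (or for \<open>T\<^sup>*\<close> and \<open>T\<close>), the left ideal contains the identity; then \<open>S\<^sup>*S + SS\<^sup>*\<close> is bounded below,
  hence invertible. By essential normality it agrees with \<open>2S\<^sup>*S\<close> and \<open>2SS\<^sup>*\<close> modulo compact
  operators, so \<open>S\<close> is invertible in the Calkin algebra. Hence every essential spectral value \<open>z\<close> is
  real in the first case and satisfies \<open>\<bar>z\<bar> = \<bar>z\<bar>^n\<close> in the second.
\<close>

section \<open>Complex scalars\<close>

lemma scaleC_minus_right: "c *\<^sub>C (- x) = - (c *\<^sub>C (x :: 'a::complex_vector))"
proof -
  have "c *\<^sub>C (0::'a) = 0"
    using scaleC_add_right[of c 0 "0::'a"] by simp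
  then have "c *\<^sub>C (- x) + c *\<^sub>C x = 0"
    by (simp flip: scaleC_add_right)
  then show ?thesis
    by (simp add: eq_neg_iff_add_eq_0)
qed

lemma scaleC_diff_right: "c *\<^sub>C (x - y) = c *\<^sub>C x - c *\<^sub>C (y :: 'a::complex_vector)"
  using scaleC_add_right[of c x "- y"] by (simp add: scaleC_minus_right)

lemma scaleC_diff_left: "(c - d) *\<^sub>C x = c *\<^sub>C x - d *\<^sub>C (x :: 'a::complex_vector)"
  using scaleC_add_left[of "c - d" d x] by (simp add: algebra_simps)

lemma scaleC_scaleR: "c *\<^sub>C (r *\<^sub>R x) = r *\<^sub>R (c *\<^sub>C (x :: 'a::complex_vector))"
  by (simp add: scaleC_scaleC mult.commute flip: scaleC_of_real)

lemma scaleC_one: "1 *\<^sub>C x = (x :: 'a::complex_vector)"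
  using scaleC_of_real[of 1 x] by simp

lemma cinner_scaleC_right:
  "cinner x (c *\<^sub>C y) = cnj c * cinner x (y :: 'a::complex_hilbert)"
  by (subst (1 2) cinner_commute) (simp add: cinner_scaleC_left)

lemma cinner_add_right:
  "cinner x (y + z) = cinner x y + cinner x (z :: 'a::complex_hilbert)"
  by (subst (1 2 3) cinner_commute) (simp add: cinner_add_left)

lemma cinner_diff_left:
  "cinner (x - y) z = cinner x z - cinner y (z :: 'a::complex_hilbert)"
  using cinner_add_left[of "x - y" y z] by simp

lemma cinner_diff_right:
  "cinner x (y - z) = cinner x y - cinner x (z :: 'a::complex_hilbert)"
  using cinner_add_right[of x "y - z" z] by simp

lemma norm_scaleC: "norm (c *\<^sub>C x) = norm c * norm (x :: 'a::complex_hilbert)"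
proof -
  have "(norm (c *\<^sub>C x))\<^sup>2 = Re (cinner (c *\<^sub>C x) (c *\<^sub>C x))"
    by (simp add: power2_norm_eq_inner Re_cinner)
  also have "\<dots> = Re (c * cnj c * cinner x x)"
    by (simp only: cinner_scaleC_left cinner_scaleC_right mult_ac)
  also have "\<dots> = (norm c * norm x)\<^sup>2"
    unfolding complex_norm_square[symmetric]
    by (simp add: Re_cinner power_mult_distrib power2_norm_eq_inner flip: of_real_power)
  finally show ?thesis
    by simp
qed

text \<open>The imaginary part of a complex inner product is its real part after multiplying the
  first argument by \<open>- \<i>\<close>. Complex homogeneity of \<open>T\<close> thus lifts the
  real adjoint identity, which the real Riesz theorem provides, to the complex one.\<close>

lemma cinner_eqI_Re:
  fixes T S :: "'a::complex_hilbert \<Rightarrow> 'a"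
  assumes "\<And>c x. T (c *\<^sub>C x) = c *\<^sub>C T x" and "\<And>x. inner (T x) y = inner x w"
  shows "cinner (T x) y = cinner x w"
proof (rule complex_eqI)
  show "Re (cinner (T x) y) = Re (cinner x w)"
    using assms(2) by (simp add: Re_cinner)
  have "Re (cinner (T (- \<i> *\<^sub>C x)) y) = Re (cinner (- \<i> *\<^sub>C x) w)"
    using assms(2) by (simp add: Re_cinner)
  then show "Im (cinner (T x) y) = Im (cinner x w)"
    by (simp add: assms(1) cinner_scaleC_left)
qed

section \<open>Bounded operators\<close>

lemma bounded_ops_linear: "T \<in> bounded_ops \<Longrightarrow> bounded_linear T"
  by (simp add: bounded_ops_def)

lemma bounded_ops_scaleC: "T \<in> bounded_ops \<Longrightarrow> T (c *\<^sub>C x) = c *\<^sub>C T x"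
  by (simp add: bounded_ops_def)

lemma bounded_ops_comp: "S \<in> bounded_ops \<Longrightarrow> T \<in> bounded_ops \<Longrightarrow> S \<circ> T \<in> bounded_ops"
  by (auto simp: bounded_ops_def o_def intro: bounded_linear_compose)

lemma bounded_ops_add:
  "S \<in> bounded_ops \<Longrightarrow> T \<in> bounded_ops \<Longrightarrow> (\<lambda>x. S x + T x) \<in> bounded_ops"
  by (auto simp: bounded_ops_def scaleC_add_right intro: bounded_linear_add)

lemma bounded_ops_diff:
  "S \<in> bounded_ops \<Longrightarrow> T \<in> bounded_ops \<Longrightarrow> (\<lambda>x. S x - T x) \<in> bounded_ops"
  by (auto simp: bounded_ops_def scaleC_diff_right intro: bounded_linear_sub)

lemma bounded_ops_scalar: "(\<lambda>x :: 'a::complex_hilbert. c *\<^sub>C x) \<in> bounded_ops"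
proof -
  have "bounded_linear (\<lambda>x :: 'a. c *\<^sub>C x)"
    by (rule bounded_linear_intro[where K = "norm c"])
      (auto simp: scaleC_add_right scaleC_scaleR norm_scaleC)
  then show ?thesis
    by (auto simp: bounded_ops_def scaleC_scaleC mult.commute)
qed

text \<open>The representing vector of \<open>f\<close> minimises \<open>\<parallel>x\<parallel>\<^sup>2 - 2 f x\<close>.\<close>

theorem riesz_representation:
  fixes f :: "'a::{real_inner, complete_space} \<Rightarrow> real"
  assumes f: "bounded_linear f"
  shows "\<exists>y. \<forall>x. f x = inner x y"
proof -
  interpret f: bounded_linear f by (rule f)
  define J where "J x = (norm x)\<^sup>2 - 2 * f x" for x
  obtain M where M: "\<And>x. norm (f x) \<le> norm x * M"
    using f.bounded by blast
  \<comment> \<open>Completing the square in \<open>norm x\<close> bounds \<open>J\<close> below, so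
    the infimum \<open>d\<close> is finite.\<close>
  have lower: "- M\<^sup>2 \<le> J x" for x
  proof -
    have "f x \<le> norm x * M" using M[of x] by simp
    moreover have "0 \<le> (norm x - M)\<^sup>2" by simp
    ultimately show ?thesis by (simp add: J_def power2_diff)
  qed
  define d where "d = Inf (range J)"
  have bdd: "bdd_below (range J)"
    using lower by (auto simp: bdd_below_def)
  have dJ: "d \<le> J x" for x
    unfolding d_def by (rule cInf_lower) (use bdd in auto)
  have "\<exists>x. J x < d + 1 / Suc n" for n
    using cInf_lessD[of "range J" "d + 1 / Suc n"] by (auto simp: d_def)
  then obtain X where X: "\<And>n. J (X n) < d + 1 / Suc n"
    by metis
  \<comment> \<open>The midpoint of \<open>x\<close> and \<open>y\<close> has \<open>J\<close>-value
    at least \<open>d\<close>, so two points that almost attain the infimum are close to each other.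
    This makes the minimising sequence \<open>X\<close> Cauchy.\<close>
  have parallelogram: "(norm (x - y))\<^sup>2 \<le> 2 * (J x + J y - 2 * d)" for x y
  proof -
    have "J x + J y = 2 * J ((1/2) *\<^sub>R (x + y)) + (norm (x - y))\<^sup>2 / 2"
      unfolding J_def f.scaleR f.add
      by (simp add: power2_norm_eq_inner inner_add_left inner_add_right inner_diff_left
          inner_diff_right inner_commute field_simps)
    with dJ[of "(1/2) *\<^sub>R (x + y)"] show ?thesis
      by argo
  qed
  have "Cauchy X"
  proof (rule metric_CauchyI)
    fix e :: real assume "0 < e"
    \<comment> \<open>For indices beyond \<open>N\<close> each \<open>J\<close>-value exceeds
      \<open>d\<close> by less than \<open>1 / Suc N\<close>, and the parallelogram bound doubles
      the sum of the two excesses: hence the 4.\<close>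
    then obtain N where N: "4 / real (Suc N) < e\<^sup>2"
      using reals_Archimedean[of "e\<^sup>2 / 4"] by (auto simp: field_simps)
    have "dist (X m) (X n) < e" if "m \<ge> N" "n \<ge> N" for m n
    proof -
      have "1 / real (Suc m) \<le> 1 / real (Suc N)" "1 / real (Suc n) \<le> 1 / real (Suc N)"
        using that by (auto simp: field_simps)
      then have "(norm (X m - X n))\<^sup>2 < e\<^sup>2"
        using parallelogram[of "X m" "X n"] X[of m] X[of n] N by argo
      then show ?thesis
        using \<open>0 < e\<close> by (simp add: dist_norm power_less_imp_less_base)
    qed
    then show "\<exists>N. \<forall>m\<ge>N. \<forall>n\<ge>N. dist (X m) (X n) < e"
      by blast
  qed
  then obtain y where y: "X \<longlonglongrightarrow> y"
    using Cauchy_convergent_iff convergent_def by blast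
  have "(\<lambda>n. J (X n)) \<longlonglongrightarrow> J y"
    unfolding J_def using y by (intro tendsto_intros f.tendsto)
  moreover have "(\<lambda>n. d + 1 / Suc n) \<longlonglongrightarrow> d + 0"
    using LIMSEQ_inverse_real_of_nat by (intro tendsto_intros) (simp add: inverse_eq_divide)
  ultimately have "J y \<le> d + 0"
    using X by (intro LIMSEQ_le) (auto intro: less_imp_le)
  then have min: "J y \<le> J x" for x
    using dJ[of x] by simp
  have "f v = inner v y" for v
  proof -
    \<comment> \<open>Moving from the minimiser \<open>y\<close> by \<open>t *\<^sub>R v\<close>
      changes \<open>J\<close> by \<open>2 * t * a + t\<^sup>2 * N\<close>, which cannot be
      negative. The chosen \<open>t\<close> makes it negative unless \<open>a = 0\<close>; the
      denominator \<open>N + 1\<close> also covers \<open>v = 0\<close>.\<close>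
    define a where "a = inner v y - f v"
    define N where "N = (norm v)\<^sup>2"
    define t where "t = - a / (N + 1)"
    have "N \<ge> 0" by (simp add: N_def)
    have "J (y + t *\<^sub>R v) = J y + 2 * t * a + t\<^sup>2 * N"
      unfolding J_def f.scaleR f.add a_def N_def
      by (simp add: power2_norm_eq_inner inner_add_left inner_add_right inner_commute
          algebra_simps power2_eq_square[of t])
    with min have "0 \<le> 2 * t * a + t\<^sup>2 * N"
      by (smt (verit))
    also have "2 * t * a + t\<^sup>2 * N = - (a\<^sup>2 * (N + 2)) / (N + 1)\<^sup>2"
      using \<open>N \<ge> 0\<close> by (simp add: t_def power2_eq_square divide_simps) (simp add: algebra_simps)
    finally have "a\<^sup>2 * (N + 2) \<le> 0"
      using \<open>N \<ge> 0\<close> by (simp add: divide_simps split: if_splits)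
    then have "a = 0"
      using \<open>N \<ge> 0\<close> by (simp add: mult_le_0_iff)
    then show ?thesis by (simp add: a_def)
  qed
  then show ?thesis by blast
qed

section \<open>Existence, uniqueness and boundedness of adjoints\<close>

lemma cadjoint_cinner:
  assumes T: "T \<in> bounded_ops"
  shows "cinner (T x) y = cinner x (cadjoint T y)"
proof -
  \<comment> \<open>\<open>cadjoint\<close> is a choice, so its defining property has to be shown
    satisfiable: Riesz gives a vector \<open>w\<close> for each \<open>y\<close>.\<close>
  have "\<exists>w. \<forall>x. cinner (T x) y = cinner x w" for y
  proof -
    have "bounded_linear (\<lambda>x. inner (T x) y)"
      using bounded_linear_compose[OF bounded_linear_inner_left bounded_ops_linear[OF T]] .
    then obtain w where "\<And>x. inner (T x) y = inner x w"
      using riesz_representation by blast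
    then show ?thesis
      using cinner_eqI_Re[of T y w] bounded_ops_scaleC[OF T] by blast
  qed
  then have "\<exists>S. \<forall>x y. cinner (T x) y = cinner x (S y)"
    by metis
  then have "\<forall>x y. cinner (T x) y = cinner x (cadjoint T y)"
    unfolding cadjoint_def by (rule someI_ex)
  then show ?thesis by blast
qed

lemma cinner_ext:
  fixes v w :: "'a::complex_hilbert"
  assumes "\<And>x. cinner x v = cinner x w"
  shows "v = w"
proof -
  have "inner (v - w) v = inner (v - w) w"
    using assms[of "v - w"] by (simp flip: Re_cinner)
  then have "inner (v - w) (v - w) = 0"
    by (simp add: inner_diff_right)
  then show ?thesis by simp
qed

text \<open>The existence of \<open>S\<close> makes the choice in \<open>cadjoint\<close> satisfy
  the same identity, and inner products with all \<open>x\<close> determine a vector.\<close>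

lemma cadjoint_eqI:
  assumes "\<And>x y. cinner (T x) y = cinner x (S y)"
  shows "cadjoint T = S"
proof -
  have "\<forall>x y. cinner (T x) y = cinner x (cadjoint T y)"
    unfolding cadjoint_def by (rule someI[of _ S]) (use assms in blast)
  then show ?thesis
    using assms by (intro ext cinner_ext) metis
qed

lemma cadjoint_cinner':
  assumes "T \<in> bounded_ops"
  shows "cinner (cadjoint T x) y = cinner x (T y)"
  using cadjoint_cinner[OF assms, of y x] by (metis cinner_commute)

lemma cadjoint_cadjoint: "T \<in> bounded_ops \<Longrightarrow> cadjoint (cadjoint T) = T"
  by (rule cadjoint_eqI) (rule cadjoint_cinner')

lemma cadjoint_inner:
  "T \<in> bounded_ops \<Longrightarrow> inner (T x) y = inner x (cadjoint T y)"
  "T \<in> bounded_ops \<Longrightarrow> inner (cadjoint T x) y = inner x (T y)"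
  by (simp_all add: cadjoint_cinner cadjoint_cinner' flip: Re_cinner)

lemma cadjoint_bounded_ops:
  assumes T: "T \<in> bounded_ops"
  shows "cadjoint T \<in> bounded_ops"
proof -
  obtain M where M: "M > 0" "\<And>x. norm (T x) \<le> norm x * M"
    using bounded_linear.pos_bounded[OF bounded_ops_linear[OF T]] by blast
  have add: "cadjoint T (x + y) = cadjoint T x + cadjoint T y" for x y
    by (rule cinner_ext) (simp add: cinner_add_right flip: cadjoint_cinner[OF T])
  have scale: "cadjoint T (c *\<^sub>C x) = c *\<^sub>C cadjoint T x" for c x
    by (rule cinner_ext) (simp add: cinner_scaleC_right flip: cadjoint_cinner[OF T])
  have "norm (cadjoint T x) \<le> norm x * M" for x
  proof (cases "cadjoint T x = 0")
    case False
    \<comment> \<open>Moving one factor across the inner product leaves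
      \<open>norm (cadjoint T x)\<close> on both sides; it cancels because it is nonzero in this
      case.\<close>
    have "(norm (cadjoint T x))\<^sup>2 = inner (T (cadjoint T x)) x"
      by (simp add: power2_norm_eq_inner cadjoint_inner[OF T])
    also have "\<dots> \<le> norm (T (cadjoint T x)) * norm x"
      by (rule norm_cauchy_schwarz)
    also have "\<dots> \<le> norm (cadjoint T x) * M * norm x"
      by (intro mult_right_mono M) auto
    finally have "norm (cadjoint T x) * norm (cadjoint T x) \<le> norm (cadjoint T x) * (norm x * M)"
      by (simp add: power2_eq_square algebra_simps)
    with False show ?thesis
      by simp
  qed (use M in auto)
  then have "bounded_linear (cadjoint T)"
    using add scale by (intro bounded_linear_intro[where K = M]) (simp_all flip: scaleC_of_real)
  then show ?thesis
    by (simp add: bounded_ops_def scale)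
qed

lemma cadjoint_add:
  assumes "S \<in> bounded_ops" "T \<in> bounded_ops"
  shows "cadjoint (\<lambda>x. S x + T x) = (\<lambda>x. cadjoint S x + cadjoint T x)"
  by (rule cadjoint_eqI) (simp add: assms cinner_add_left cinner_add_right cadjoint_cinner)

lemma cadjoint_diff_scalar:
  assumes "T \<in> bounded_ops"
  shows "cadjoint (\<lambda>x. T x - z *\<^sub>C x) = (\<lambda>x. cadjoint T x - cnj z *\<^sub>C x)"
  by (rule cadjoint_eqI)
    (simp add: assms cinner_diff_left cinner_diff_right cadjoint_cinner
      cinner_scaleC_left cinner_scaleC_right)

text \<open>A coercive operator \<open>Q\<close> is inverted by iterating the contraction \<open>x \<mapsto> x - \<rho>(Qx - b)\<close> for
  small \<open>\<rho>\<close>.\<close>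

theorem coercive_invertible:
  assumes Q: "Q \<in> bounded_ops" and c: "c > 0"
    and coercive: "\<And>x. c * (norm x)\<^sup>2 \<le> inner (Q x) x"
  obtains R where "R \<in> bounded_ops" "R \<circ> Q = id" "Q \<circ> R = id"
proof -
  interpret Q: bounded_linear Q by (rule bounded_ops_linear[OF Q])
  obtain M where M: "M > 0" "\<And>x. norm (Q x) \<le> norm x * M"
    using Q.pos_bounded by blast
  \<comment> \<open>Enlarging the bound \<open>M\<close> to at least \<open>c\<close> keeps
    \<open>1 - c\<^sup>2 / L\<^sup>2\<close> nonnegative, so that its root \<open>k\<close> is a
    contraction constant.\<close>
  define L where "L = max M c"
  have L: "L > 0" "c \<le> L" "norm (Q x) \<le> L * norm x" for x
  proof -
    show "norm (Q x) \<le> L * norm x"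
      using M(2)[of x] mult_right_mono[of M L "norm x"] by (simp add: L_def mult.commute)
  qed (use M c in \<open>auto simp: L_def\<close>)
  \<comment> \<open>Coercivity and the bound \<open>L\<close> give the factor
    \<open>1 - 2 * r * c + r\<^sup>2 * L\<^sup>2\<close> for the squared norm of
    \<open>x - r *\<^sub>R Q x\<close>; this \<open>r\<close> minimises it, with value
    \<open>k\<^sup>2\<close>.\<close>
  define r where "r = c / L\<^sup>2"
  define k where "k = sqrt (1 - c\<^sup>2 / L\<^sup>2)"
  have "c\<^sup>2 \<le> L\<^sup>2"
    using L(2) c by (intro power_mono) auto
  then have le1: "c\<^sup>2 / L\<^sup>2 \<le> 1" using L(1) by simp
  have pos: "c\<^sup>2 / L\<^sup>2 > 0" using c L(1) by simp
  have k: "0 \<le> k" "k < 1"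
    using le1 pos by (auto simp: k_def)
  have contraction: "norm (x - r *\<^sub>R Q x) \<le> k * norm x" for x
  proof (rule power2_le_imp_le)
    have "(norm (x - r *\<^sub>R Q x))\<^sup>2 = (norm x)\<^sup>2 - 2 * r * inner (Q x) x + r\<^sup>2 * (norm (Q x))\<^sup>2"
      by (simp add: power2_norm_eq_inner inner_diff_left inner_diff_right inner_commute
          algebra_simps power2_eq_square[of r])
    also have "\<dots> \<le> (norm x)\<^sup>2 - 2 * r * (c * (norm x)\<^sup>2) + r\<^sup>2 * (L * norm x)\<^sup>2"
      using coercive[of x] L c
      by (intro add_mono diff_mono mult_left_mono power_mono) (auto simp: r_def)
    also have "\<dots> = (1 - c\<^sup>2 / L\<^sup>2) * (norm x)\<^sup>2"
      using L(1) by (simp add: r_def power2_eq_square field_simps)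
    also have "\<dots> = (k * norm x)\<^sup>2"
      using le1 by (simp add: k_def power_mult_distrib)
    finally show "(norm (x - r *\<^sub>R Q x))\<^sup>2 \<le> (k * norm x)\<^sup>2" .
  qed (use k in simp)
  have surj: "\<exists>x. Q x = b" for b
  proof -
    let ?f = "\<lambda>x. x - r *\<^sub>R (Q x - b)"
    have "dist (?f x) (?f y) \<le> k * dist x y" for x y
      using contraction[of "x - y"] by (simp add: dist_norm Q.diff algebra_simps)
    then obtain x where "?f x = x"
      using banach_fix_type[of k ?f] k by blast
    then show ?thesis
      using c L(1) by (auto simp: r_def)
  qed
  \<comment> \<open>Coercivity with Cauchy-Schwarz; it yields both injectivity of \<open>Q\<close>
    and the bound \<open>1 / c\<close> for the inverse.\<close>
  have below: "c * norm x \<le> norm (Q x)" for x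
  proof (cases "x = 0")
    case False
    have "c * norm x * norm x \<le> norm (Q x) * norm x"
      using coercive[of x] norm_cauchy_schwarz[of "Q x" x] by (simp add: power2_eq_square mult.assoc)
    with False show ?thesis by simp
  qed (simp add: Q.zero)
  have inj: "x = y" if "Q x = Q y" for x y
    using below[of "x - y"] c that by (simp add: Q.diff mult_le_0_iff)
  obtain R where R: "\<And>b. Q (R b) = b"
    using surj by metis
  have RQ: "R (Q x) = x" for x
    using inj R by blast
  have "bounded_linear R"
  proof (rule bounded_linear_intro[where K = "1 / c"])
    show "R (x + y) = R x + R y" for x y
      by (rule inj) (simp add: R Q.add)
    show "R (a *\<^sub>R x) = a *\<^sub>R R x" for a x
      by (rule inj) (simp add: R Q.scaleR)
    show "norm (R x) \<le> norm x * (1 / c)" for x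
      using below[of "R x"] c by (simp add: R field_simps)
  qed
  moreover have "R (a *\<^sub>C x) = a *\<^sub>C R x" for a x
    by (rule inj) (simp add: R bounded_ops_scaleC[OF Q])
  ultimately have "R \<in> bounded_ops"
    by (simp add: bounded_ops_def)
  with R RQ show thesis
    by (intro that) (auto simp: fun_eq_iff)
qed

section \<open>Compact operators and the Calkin algebra\<close>

lemma compact_ops_bounded: "T \<in> compact_ops \<Longrightarrow> T \<in> bounded_ops"
  by (simp add: compact_ops_def)

lemma compact_ops_comp:
  assumes "K \<in> compact_ops" "S \<in> bounded_ops"
  shows "S \<circ> K \<in> compact_ops" "K \<circ> S \<in> compact_ops"
  using ideal.I_l_closed[OF ideal_compact_ops, of K S]
    ideal.I_r_closed[OF ideal_compact_ops, of K S] assms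
  by (simp_all add: op_ring_def)

text \<open>A finite net for the image of the unit ball under \<open>KK\<^sup>*\<close> yields one for its image under \<open>K\<^sup>*\<close>,
  because \<open>\<parallel>K\<^sup>*u\<parallel>\<^sup>2 = \<langle>KK\<^sup>*u, u\<rangle>\<close>.\<close>

theorem cadjoint_compact_ops:
  assumes K: "K \<in> compact_ops"
  shows "cadjoint K \<in> compact_ops"
proof -
  have Kb: "K \<in> bounded_ops" by (rule compact_ops_bounded[OF K])
  define A where "A = cadjoint K"
  have A: "A \<in> bounded_ops" unfolding A_def by (rule cadjoint_bounded_ops[OF Kb])
  interpret A: bounded_linear A by (rule bounded_ops_linear[OF A])
  interpret K: bounded_linear K by (rule bounded_ops_linear[OF Kb])
  have comp: "compact (closure ((K \<circ> A) ` cball 0 1))"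
    using compact_ops_comp(2)[OF K A] by (simp add: compact_ops_def)
  have "\<exists>k. finite k \<and> closure (A ` cball 0 1) \<subseteq> (\<Union>x\<in>k. ball x e)" if e: "e > 0" for e :: real
  proof -
    \<comment> \<open>Points of the unit ball are at distance at most 2, so
      \<open>\<delta> * 2 = (e / 2)\<^sup>2\<close> bounds the squared distance of their images
      under \<open>A\<close>.\<close>
    define \<delta> where "\<delta> = (e / 2)\<^sup>2 / 2"
    have \<delta>: "\<delta> > 0" using e by (simp add: \<delta>_def)
    have "closure ((K \<circ> A) ` cball 0 1) \<subseteq> (\<Union>x\<in>cball 0 1. ball ((K \<circ> A) x) \<delta>)"
    proof
      fix y assume "y \<in> closure ((K \<circ> A) ` cball 0 1)"
      then show "y \<in> (\<Union>x\<in>cball 0 1. ball ((K \<circ> A) x) \<delta>)"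
        using \<delta> unfolding closure_approachable by fastforce
    qed
    then obtain F where F: "F \<subseteq> cball 0 1" "finite F"
      "closure ((K \<circ> A) ` cball 0 1) \<subseteq> (\<Union>x\<in>F. ball ((K \<circ> A) x) \<delta>)"
      by (rule compactE_image[OF comp, rotated]) auto
    \<comment> \<open>A finite union of closed balls is closed and so covers the closure of the
      image too; the smaller radius leaves room for open balls of radius \<open>e\<close>.\<close>
    have "A ` cball 0 1 \<subseteq> (\<Union>u\<in>A ` F. cball u (e / 2))"
    proof clarify
      fix x :: 'a assume x: "x \<in> cball 0 1"
      then have "(K \<circ> A) x \<in> closure ((K \<circ> A) ` cball 0 1)"
        by (intro subsetD[OF closure_subset] imageI)
      then obtain y where y: "y \<in> F" "dist ((K \<circ> A) y) ((K \<circ> A) x) < \<delta>"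
        using F(3) by auto
      have "(norm (A y - A x))\<^sup>2 = inner (K (A (y - x))) (y - x)"
        unfolding A.diff[symmetric] by (simp add: power2_norm_eq_inner cadjoint_inner[OF Kb] A_def)
      also have "\<dots> \<le> norm (K (A (y - x))) * norm (y - x)"
        by (rule norm_cauchy_schwarz)
      also have "\<dots> \<le> \<delta> * 2"
      proof (rule mult_mono)
        show "norm (K (A (y - x))) \<le> \<delta>"
          using y(2) by (simp add: dist_norm A.diff K.diff)
        have "norm y \<le> 1" "norm x \<le> 1"
          using x y(1) F(1) by auto
        then show "norm (y - x) \<le> 2"
          using norm_triangle_ineq4[of y x] by simp
      qed (use \<delta> in auto)
      also have "\<dots> = (e / 2)\<^sup>2"
        by (simp add: \<delta>_def)
      finally have "norm (A y - A x) \<le> e / 2"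
        by (rule power2_le_imp_le) (use e in simp)
      with y(1) show "A x \<in> (\<Union>u\<in>A ` F. cball u (e / 2))"
        by (auto simp: dist_norm)
    qed
    moreover have "closed (\<Union>u\<in>A ` F. cball u (e / 2))"
      using F(2) by (intro closed_UN) auto
    ultimately have "closure (A ` cball 0 1) \<subseteq> (\<Union>u\<in>A ` F. cball u (e / 2))"
      by (rule closure_minimal)
    also have "\<dots> \<subseteq> (\<Union>u\<in>A ` F. ball u e)"
      using e by (intro UN_mono) auto
    finally show ?thesis
      using F(2) by blast
  qed
  moreover have "complete (closure (A ` cball 0 1))"
    by (simp add: complete_eq_closed)
  ultimately have "compact (closure (A ` cball 0 1))"
    by (simp add: compact_eq_totally_bounded)
  with A show ?thesis
    by (simp add: compact_ops_def A_def)
qed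

section \<open>The quotient map onto the Calkin algebra and its involution\<close>

lemma ring_calkin: "ring calkin"
  unfolding calkin_def by (rule ideal.quotient_is_ring[OF ideal_compact_ops])

lemma calkin_proj_hom: "calkin_proj \<in> ring_hom op_ring calkin"
  unfolding calkin_def calkin_proj_def[abs_def] by (rule ideal.rcos_ring_hom[OF ideal_compact_ops])

lemma calkin_proj_closed: "T \<in> bounded_ops \<Longrightarrow> calkin_proj T \<in> carrier calkin"
  using ring_hom_closed[OF calkin_proj_hom] by (simp add: op_ring_def)

lemma calkin_proj_comp:
  "S \<in> bounded_ops \<Longrightarrow> T \<in> bounded_ops \<Longrightarrow>
    calkin_proj (S \<circ> T) = calkin_proj S \<otimes>\<^bsub>calkin\<^esub> calkin_proj T"
  using ring_hom_mult[OF calkin_proj_hom, of S T] by (simp add: op_ring_def)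

lemma calkin_proj_add:
  "S \<in> bounded_ops \<Longrightarrow> T \<in> bounded_ops \<Longrightarrow>
    calkin_proj (\<lambda>x. S x + T x) = calkin_proj S \<oplus>\<^bsub>calkin\<^esub> calkin_proj T"
  using ring_hom_add[OF calkin_proj_hom, of S T] by (simp add: op_ring_def)

lemma calkin_proj_id: "calkin_proj id = \<one>\<^bsub>calkin\<^esub>"
  using ring_hom_one[OF calkin_proj_hom] by (simp add: op_ring_def)

lemma calkin_proj_diff:
  assumes "S \<in> bounded_ops" "T \<in> bounded_ops"
  shows "calkin_proj (\<lambda>x. S x - T x) = calkin_proj S \<ominus>\<^bsub>calkin\<^esub> calkin_proj T"
proof -
  interpret ring "calkin :: ('a \<Rightarrow> 'a) set ring" by (rule ring_calkin)
  have "calkin_proj S = calkin_proj (\<lambda>x. S x - T x) \<oplus>\<^bsub>calkin\<^esub> calkin_proj T"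
    using calkin_proj_add[OF bounded_ops_diff[OF assms] assms(2)] by simp
  then show ?thesis
    using calkin_proj_closed[OF assms(1)] calkin_proj_closed[OF assms(2)]
      calkin_proj_closed[OF bounded_ops_diff[OF assms]]
    by (simp add: a_minus_def a_assoc r_neg)
qed

lemma mem_calkin_proj: "X \<in> calkin_proj T \<longleftrightarrow> (\<exists>K\<in>compact_ops. X = (\<lambda>x. K x + T x))"
  by (auto simp: calkin_proj_def a_r_coset_def' op_ring_def)

text \<open>Compact operators are closed under adjoints. The reverse inclusion writes a compact
  \<open>K\<close> as the adjoint of the compact operator \<open>cadjoint K\<close>.\<close>

lemma calkin_star_proj:
  assumes T: "T \<in> bounded_ops"
  shows "calkin_star (calkin_proj T) = calkin_proj (cadjoint T)"
proof (intro Set.set_eqI iffI)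
  fix X assume "X \<in> calkin_star (calkin_proj T)"
  then obtain K where "K \<in> compact_ops" "X = cadjoint (\<lambda>x. K x + T x)"
    by (auto simp: calkin_star_def mem_calkin_proj)
  then show "X \<in> calkin_proj (cadjoint T)"
    using T by (auto simp: mem_calkin_proj cadjoint_add compact_ops_bounded
        intro!: bexI[of _ "cadjoint K"] cadjoint_compact_ops)
next
  fix X assume "X \<in> calkin_proj (cadjoint T)"
  then obtain K where K: "K \<in> compact_ops" "X = (\<lambda>x. K x + cadjoint T x)"
    by (auto simp: mem_calkin_proj)
  then have "X = cadjoint (\<lambda>x. cadjoint K x + T x)"
    using T by (simp add: cadjoint_add cadjoint_bounded_ops cadjoint_cadjoint compact_ops_bounded)
  with K(1) show "X \<in> calkin_star (calkin_proj T)"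
    by (auto simp: calkin_star_def mem_calkin_proj intro!: imageI cadjoint_compact_ops)
qed

section \<open>Essential normality and invertibility in the Calkin algebra\<close>

lemma essentially_normal_iff:
  assumes T: "T \<in> bounded_ops"
  shows "essentially_normal T \<longleftrightarrow>
    calkin_proj (cadjoint T) \<otimes>\<^bsub>calkin\<^esub> calkin_proj T =
    calkin_proj T \<otimes>\<^bsub>calkin\<^esub> calkin_proj (cadjoint T)"
  by (simp add: essentially_normal_def calkin_normal_def calkin_star_proj[OF T])

text \<open>Serves to pass normality from \<open>T\<close> to \<open>T - z\<close>: there
  \<open>c\<close> and \<open>d\<close> are cosets of scalars, which commute with all cosets because
  bounded operators are complex linear.\<close>

lemma (in ring) commute_diff_scalars:
  assumes "a \<in> carrier R" "b \<in> carrier R" "c \<in> carrier R" "d \<in> carrier R"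
    and "a \<otimes> b = b \<otimes> a" "a \<otimes> d = d \<otimes> a" "c \<otimes> b = b \<otimes> c" "c \<otimes> d = d \<otimes> c"
  shows "(a \<ominus> c) \<otimes> (b \<ominus> d) = (b \<ominus> d) \<otimes> (a \<ominus> c)"
proof -
  have "(a \<ominus> c) \<otimes> (b \<ominus> d) = a \<otimes> b \<ominus> a \<otimes> d \<ominus> c \<otimes> b \<oplus> c \<otimes> d"
    using assms(1-4) by algebra
  also have "\<dots> = b \<otimes> a \<ominus> d \<otimes> a \<ominus> b \<otimes> c \<oplus> d \<otimes> c"
    using assms(5-8) by simp
  also have "\<dots> = (b \<ominus> d) \<otimes> (a \<ominus> c)"
    using assms(1-4) by algebra
  finally show ?thesis .
qed

lemma essentially_normal_diff_scalar:
  assumes T: "T \<in> bounded_ops" and "essentially_normal T"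
  shows "essentially_normal (\<lambda>x. T x - z *\<^sub>C x)"
proof -
  interpret ring "calkin :: ('a \<Rightarrow> 'a) set ring" by (rule ring_calkin)
  define c where "c u = calkin_proj (\<lambda>x :: 'a. u *\<^sub>C x)" for u
  have c: "c u \<in> carrier calkin" for u
    by (simp add: c_def calkin_proj_closed bounded_ops_scalar)
  have comm: "calkin_proj X \<otimes>\<^bsub>calkin\<^esub> c u = c u \<otimes>\<^bsub>calkin\<^esub> calkin_proj X"
    if "X \<in> bounded_ops" for X u
    using that by (simp add: c_def bounded_ops_scalar o_def bounded_ops_scaleC flip: calkin_proj_comp)
  have cc: "c u \<otimes>\<^bsub>calkin\<^esub> c v = c v \<otimes>\<^bsub>calkin\<^esub> c u" for u v
    using comm[OF bounded_ops_scalar] by (simp add: c_def)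
  note T' = cadjoint_bounded_ops[OF T]
  have "(calkin_proj (cadjoint T) \<ominus>\<^bsub>calkin\<^esub> c (cnj z)) \<otimes>\<^bsub>calkin\<^esub> (calkin_proj T \<ominus>\<^bsub>calkin\<^esub> c z) =
    (calkin_proj T \<ominus>\<^bsub>calkin\<^esub> c z) \<otimes>\<^bsub>calkin\<^esub> (calkin_proj (cadjoint T) \<ominus>\<^bsub>calkin\<^esub> c (cnj z))"
    using assms(2) comm[OF T] comm[OF T'] cc
    by (intro commute_diff_scalars calkin_proj_closed T T' c) (auto simp: essentially_normal_iff[OF T])
  moreover have "(\<lambda>x. T x - z *\<^sub>C x) \<in> bounded_ops"
    by (intro bounded_ops_diff T bounded_ops_scalar)
  ultimately show ?thesis
    by (simp add: essentially_normal_iff cadjoint_diff_scalar T T' calkin_proj_diff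
        bounded_ops_scalar c_def)
qed

text \<open>The quadratic form of \<open>Q\<close>, the sum of the two products of \<open>S\<close>
  with its adjoint, is the sum of the squared norms of \<open>S x\<close> and
  \<open>cadjoint S x\<close>. The hypothesis therefore makes \<open>Q\<close> coercive and
  invertible, and normality lets \<open>calkin_proj S\<close> be factored out of its coset on either
  side.\<close>

lemma calkin_unit_if_bounded_below:
  assumes S: "S \<in> bounded_ops" and normal: "essentially_normal S"
    and below: "\<And>x. norm x \<le> C * (norm (S x) + norm (cadjoint S x))"
  shows "calkin_proj S \<in> Units calkin"
proof -
  interpret ring "calkin :: ('a \<Rightarrow> 'a) set ring" by (rule ring_calkin)
  define A where "A = cadjoint S"
  have A: "A \<in> bounded_ops" by (simp add: A_def cadjoint_bounded_ops S)
  define Q where "Q = (\<lambda>x. (A \<circ> S) x + (S \<circ> A) x)"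
  have Q: "Q \<in> bounded_ops"
    unfolding Q_def by (intro bounded_ops_add bounded_ops_comp A S)
  \<comment> \<open>Squaring the lower bound and using that \<open>(p + q)\<^sup>2\<close> is at
    most \<open>2 * (p\<^sup>2 + q\<^sup>2)\<close> gives \<open>2 * C\<^sup>2\<close>; the added 1
    ensures positivity.\<close>
  define D where "D = 2 * C\<^sup>2 + 1"
  have D: "D > 0" by (simp add: D_def add_nonneg_pos)
  have coercive: "1 / D * (norm x)\<^sup>2 \<le> inner (Q x) x" for x
  proof -
    have Qx: "inner (Q x) x = (norm (S x))\<^sup>2 + (norm (A x))\<^sup>2"
      by (simp add: Q_def inner_add_left cadjoint_inner[OF S] A_def power2_norm_eq_inner)
    have "(norm x)\<^sup>2 \<le> (C * (norm (S x) + norm (A x)))\<^sup>2"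
      using below[of x] by (intro power_mono) (auto simp: A_def)
    also have "\<dots> = C\<^sup>2 * (norm (S x) + norm (A x))\<^sup>2"
      by (simp add: power_mult_distrib)
    also have "\<dots> \<le> C\<^sup>2 * (2 * inner (Q x) x)"
      using sum_squares_bound[of "norm (S x)" "norm (A x)"]
      by (intro mult_left_mono) (auto simp: Qx power2_sum)
    also have "\<dots> \<le> D * inner (Q x) x"
      by (simp add: D_def Qx algebra_simps)
    finally show ?thesis
      using D by (simp add: field_simps)
  qed
  obtain R where R: "R \<in> bounded_ops" "R \<circ> Q = id" "Q \<circ> R = id"
    by (rule coercive_invertible[OF Q _ coercive]) (use D in auto)
  define s where "s = calkin_proj S"
  define a where "a = calkin_proj A"
  define r where "r = calkin_proj R"
  have [simp]: "s \<in> carrier calkin" "a \<in> carrier calkin" "r \<in> carrier calkin"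
    by (simp_all add: s_def a_def r_def calkin_proj_closed S A R)
  have as: "a \<otimes>\<^bsub>calkin\<^esub> s = s \<otimes>\<^bsub>calkin\<^esub> a"
    using normal by (simp add: essentially_normal_iff[OF S] a_def s_def A_def)
  have q: "calkin_proj Q = a \<otimes>\<^bsub>calkin\<^esub> s \<oplus>\<^bsub>calkin\<^esub> s \<otimes>\<^bsub>calkin\<^esub> a"
    unfolding Q_def a_def s_def
    by (simp only: calkin_proj_add calkin_proj_comp bounded_ops_comp A S)
  have "\<one>\<^bsub>calkin\<^esub> = r \<otimes>\<^bsub>calkin\<^esub> (a \<otimes>\<^bsub>calkin\<^esub> s \<oplus>\<^bsub>calkin\<^esub> s \<otimes>\<^bsub>calkin\<^esub> a)"
    using calkin_proj_comp[OF R(1) Q] by (simp add: R(2) calkin_proj_id q r_def)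
  then have left: "(r \<otimes>\<^bsub>calkin\<^esub> (a \<oplus>\<^bsub>calkin\<^esub> a)) \<otimes>\<^bsub>calkin\<^esub> s = \<one>\<^bsub>calkin\<^esub>"
    by (simp add: m_assoc l_distr flip: as)
  have "\<one>\<^bsub>calkin\<^esub> = (a \<otimes>\<^bsub>calkin\<^esub> s \<oplus>\<^bsub>calkin\<^esub> s \<otimes>\<^bsub>calkin\<^esub> a) \<otimes>\<^bsub>calkin\<^esub> r"
    using calkin_proj_comp[OF Q R(1)] by (simp add: R(3) calkin_proj_id q r_def)
  then have right: "s \<otimes>\<^bsub>calkin\<^esub> ((a \<oplus>\<^bsub>calkin\<^esub> a) \<otimes>\<^bsub>calkin\<^esub> r) = \<one>\<^bsub>calkin\<^esub>"
    by (simp add: r_distr as flip: m_assoc)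
  \<comment> \<open>A left and a right inverse of \<open>s\<close> coincide, so a single two-sided
    inverse results.\<close>
  have "r \<otimes>\<^bsub>calkin\<^esub> (a \<oplus>\<^bsub>calkin\<^esub> a) = (a \<oplus>\<^bsub>calkin\<^esub> a) \<otimes>\<^bsub>calkin\<^esub> r"
    by (rule inv_unique[OF left right]) auto
  with left right show ?thesis
    unfolding Units_def s_def[symmetric] by (auto intro!: bexI[of _ "r \<otimes>\<^bsub>calkin\<^esub> (a \<oplus>\<^bsub>calkin\<^esub> a)"])
qed

section \<open>Words in \<open>T\<close> and its adjoint\<close>

lemma foldr_comp_append: "foldr (\<circ>) (xs @ ys) id = foldr (\<circ>) xs id \<circ> foldr (\<circ>) ys id"
  by (induction xs) (auto simp: o_assoc)

lemma SI_semigroup_adjoint: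
  fixes T :: "'a::complex_hilbert \<Rightarrow> 'a"
  assumes "SI_semigroup (op_semigroup T)"
  shows "cadjoint T = T \<or>
    (\<exists>ws. 2 \<le> length ws \<and> set ws \<subseteq> {T, cadjoint T} \<and> cadjoint T = foldr (\<circ>) ws id)"
proof -
  define L where "L = {foldr (\<circ>) ws id | ws. 2 \<le> length ws \<and> set ws \<subseteq> {T, cadjoint T}}"
  have T: "T = foldr (\<circ>) [T] id" by simp
  have LS: "L \<subseteq> op_semigroup T"
    unfolding L_def op_semigroup_def by fastforce
  have TS: "T \<in> op_semigroup T"
    unfolding op_semigroup_def using T by fastforce
  have prod: "X \<circ> Y \<in> L" if XY: "X \<in> op_semigroup T" "Y \<in> op_semigroup T" for X Y
  proof -
    obtain xs ys where "X = foldr (\<circ>) xs id" "Y = foldr (\<circ>) ys id" "xs \<noteq> []" "ys \<noteq> []"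
      "set xs \<subseteq> {T, cadjoint T}" "set ys \<subseteq> {T, cadjoint T}"
      using XY unfolding op_semigroup_def by blast
    moreover from this have "2 \<le> length (xs @ ys)"
      by (cases xs; cases ys) auto
    ultimately show ?thesis
      unfolding L_def by (auto simp only: foldr_comp_append[symmetric] set_append intro!: exI[of _ "xs @ ys"])
  qed
  \<comment> \<open>Multiplying any member by a semigroup element gives a word of length at least
    two, which lies in \<open>L\<close>. As \<open>T\<close> itself belongs to the ideal, so must
    its adjoint.\<close>
  have "semigroup_ideal (insert T L) (op_semigroup T)"
    unfolding semigroup_ideal_def using LS TS prod by blast
  then have "cadjoint T \<in> insert T L"
    using assms unfolding SI_semigroup_def by blast
  then show ?thesis
    unfolding L_def by blast
qed

text \<open>The quantitative form of reduction modulo the left ideal: \<open>C\<close> may depend on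
  the word but not on \<open>x\<close>. Only the modulus of the scalar \<open>w\<close> is recorded,
  since the final argument compares moduli.\<close>

lemma word_approx_scalar:
  fixes T :: "'a::complex_hilbert \<Rightarrow> 'a" and z :: complex
  assumes T: "T \<in> bounded_ops" and ws: "set ws \<subseteq> {T, cadjoint T}"
  defines "N \<equiv> \<lambda>x. norm (T x - z *\<^sub>C x) + norm (cadjoint T x - cnj z *\<^sub>C x)"
  shows "\<exists>w C. norm w = norm z ^ length ws \<and> (\<forall>x. norm (foldr (\<circ>) ws id x - w *\<^sub>C x) \<le> C * N x)"
  using ws
proof (induction ws)
  case Nil
  show ?case
    by (rule exI[of _ 1], rule exI[of _ 0]) (simp add: scaleC_one)
next
  case (Cons W ws)
  then obtain p C where p: "norm p = norm z ^ length ws"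
    and C: "\<And>x. norm (foldr (\<circ>) ws id x - p *\<^sub>C x) \<le> C * N x"
    using Cons.IH Cons.prems by (meson set_subset_Cons subset_trans)
  have W: "W \<in> bounded_ops"
    using Cons.prems T cadjoint_bounded_ops[OF T] by auto
  interpret W: bounded_linear W by (rule bounded_ops_linear[OF W])
  obtain B where B: "B > 0" "\<And>x. norm (W x) \<le> norm x * B"
    using W.pos_bounded by blast
  obtain u where u: "norm u = norm z" "\<And>x. norm (W x - u *\<^sub>C x) \<le> N x"
  proof (cases "W = T")
    case True
    then show ?thesis by (intro that[of z]) (auto simp: N_def)
  next
    case False
    then have "W = cadjoint T" using Cons.prems by auto
    then show ?thesis by (intro that[of "cnj z"]) (auto simp: N_def)
  qed
  have "norm (foldr (\<circ>) (W # ws) id x - (p * u) *\<^sub>C x) \<le> (C * B + norm p) * N x" for x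
  proof -
    let ?P = "foldr (\<circ>) ws id x"
    \<comment> \<open>Insert \<open>p *\<^sub>C W x\<close>: the first term is controlled by the
      induction hypothesis and the bound \<open>B\<close> of \<open>W\<close>, the second by the
      approximation of the single letter \<open>W\<close> by \<open>u\<close>.\<close>
    have "foldr (\<circ>) (W # ws) id x - (p * u) *\<^sub>C x = W (?P - p *\<^sub>C x) + p *\<^sub>C (W x - u *\<^sub>C x)"
      by (simp add: W.diff bounded_ops_scaleC[OF W] scaleC_diff_right scaleC_scaleC)
    then have "norm (foldr (\<circ>) (W # ws) id x - (p * u) *\<^sub>C x)
        \<le> norm (W (?P - p *\<^sub>C x)) + norm p * norm (W x - u *\<^sub>C x)"
      by (metis norm_triangle_ineq norm_scaleC)
    also have "\<dots> \<le> C * N x * B + norm p * N x"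
      using B(1) C[of x]
      by (intro add_mono order_trans[OF B(2)] mult_right_mono mult_left_mono u(2)) auto
    finally show ?thesis
      by (simp add: algebra_simps)
  qed
  moreover have "norm (p * u) = norm z ^ length (W # ws)"
    by (simp add: norm_mult p u(1))
  ultimately show ?case
    by blast
qed

text \<open>Were the scalars different, \<open>(cnj z - w) *\<^sub>C x\<close> would be a difference
  of two vectors, each bounded by a multiple of the norms of \<open>(T - z) x\<close> and its
  adjoint counterpart. Then \<open>T - z\<close> would have an invertible coset, contrary to the
  choice of \<open>z\<close>.\<close>

lemma essential_spectrum_approx_scalar:
  fixes T :: "'a::complex_hilbert \<Rightarrow> 'a"
  assumes T: "T \<in> bounded_ops" and normal: "essentially_normal T"
    and z: "z \<in> essential_spectrum T"
    and approx: "\<And>x. norm (cadjoint T x - w *\<^sub>C x)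
      \<le> C * (norm (T x - z *\<^sub>C x) + norm (cadjoint T x - cnj z *\<^sub>C x))"
  shows "cnj z = w"
proof (rule ccontr)
  assume "cnj z \<noteq> w"
  define S where "S = (\<lambda>x. T x - z *\<^sub>C x)"
  define k where "k = norm (cnj z - w)"
  have k: "k > 0" using \<open>cnj z \<noteq> w\<close> by (simp add: k_def)
  have S: "S \<in> bounded_ops"
    unfolding S_def by (intro bounded_ops_diff T bounded_ops_scalar)
  have S': "cadjoint S = (\<lambda>x. cadjoint T x - cnj z *\<^sub>C x)"
    unfolding S_def by (rule cadjoint_diff_scalar[OF T])
  have "norm x \<le> (C + 1) / k * (norm (S x) + norm (cadjoint S x))" for x
  proof -
    let ?d = "norm (S x) + norm (cadjoint S x)"
    have "(cnj z - w) *\<^sub>C x = (cadjoint T x - w *\<^sub>C x) - (cadjoint T x - cnj z *\<^sub>C x)"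
      by (simp add: scaleC_diff_left)
    then have "k * norm x \<le> norm (cadjoint T x - w *\<^sub>C x) + norm (cadjoint T x - cnj z *\<^sub>C x)"
      unfolding k_def by (metis norm_scaleC norm_triangle_ineq4)
    also have "\<dots> \<le> C * ?d + ?d"
      using approx[of x] unfolding S' by (intro add_mono) (auto simp: S_def)
    finally show ?thesis
      using k by (simp add: field_simps)
  qed
  then have "calkin_proj S \<in> Units calkin"
    using essentially_normal_diff_scalar[OF T normal]
    by (intro calkin_unit_if_bounded_below[OF S, where C = "(C + 1) / k"]) (simp_all add: S_def)
  then show False
    using z by (simp add: essential_spectrum_def calkin_spectrum_def S_def calkin_proj_diff T
        bounded_ops_scalar)
qed

theorem corollary4p15:
  fixes T :: "'a::complex_hilbert \<Rightarrow> 'a"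
  assumes "T \<in> bounded_ops"
    and "essentially_normal T"
    and "SI_semigroup (op_semigroup T)"
  shows "essential_spectrum T \<subseteq> \<real> \<or> essential_spectrum T \<subseteq> sphere 0 1 \<union> {0}"
  using SI_semigroup_adjoint[OF assms(3)]
proof
  assume "cadjoint T = T"
  \<comment> \<open>Take \<open>w = z\<close>: as \<open>T\<close> is selfadjoint, the norm to be
    bounded is the first summand on the right.\<close>
  then have "cnj z = z" if "z \<in> essential_spectrum T" for z
    by (intro essential_spectrum_approx_scalar[OF assms(1,2) that, where C = 1]) simp
  then show ?thesis
    by (auto simp: Reals_cnj_iff)
next
  assume "\<exists>ws. 2 \<le> length ws \<and> set ws \<subseteq> {T, cadjoint T} \<and> cadjoint T = foldr (\<circ>) ws id"
  then obtain ws where len: "2 \<le> length ws" and ws: "set ws \<subseteq> {T, cadjoint T}"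
    and eq: "foldr (\<circ>) ws id = cadjoint T"
    by metis
  have "norm z = 1 \<or> z = 0" if z: "z \<in> essential_spectrum T" for z
  proof -
    obtain w C where w: "norm w = norm z ^ length ws"
      and "\<And>x. norm (cadjoint T x - w *\<^sub>C x)
        \<le> C * (norm (T x - z *\<^sub>C x) + norm (cadjoint T x - cnj z *\<^sub>C x))"
      using word_approx_scalar[OF assms(1) ws, of z] unfolding eq by blast
    then have "cnj z = w"
      using essential_spectrum_approx_scalar[OF assms(1,2) z] by blast
    then have "norm z ^ length ws = norm z"
      using w by (metis complex_mod_cnj)
    \<comment> \<open>Cancelling one factor of a nonzero modulus leaves the exponent
      \<open>length ws - 1\<close>, which is positive because the word has length at least two; this
      forces modulus 1.\<close>
    moreover have "norm z ^ length ws = norm z * norm z ^ (length ws - 1)"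
      using len by (cases "length ws") auto
    ultimately have "z = 0 \<or> norm z ^ (length ws - 1) = 1"
      by simp
    then show ?thesis
      using len power_eq_1_iff[of "norm z" "length ws - 1"] by auto
  qed
  then have "essential_spectrum T \<subseteq> sphere 0 1 \<union> {0}"
    by fastforce
  then show ?thesis ..
qed

end
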